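(* Let $k\ge 2$ and $2^k<n\le 2^{k+1}$ be integers, and let $PG_n$ be the Pascal graph on $n$ vertices. Then $$i(PG_n)\le \delta_n+1+2^{\lfloor n/2\rfloor-1}-(\delta_{2^k-2}-1)\,\tilde\delta_{n-2^k-3}-\tilde\delta_{n-2^k-1}\left(2\prod_{i=1}^{k-1}\tilde\delta_{2^i-1}+\sum_{i=1}^{k-1}(\delta_{2^i-2}-1)\,\tilde\delta_{2^i-3}\,\alpha_{i+1}\right),$$ where $\tilde\delta_m=1$ for $m<0$, and $\alpha_{i+1}=1$ if $i=k-1$, while $\alpha_{i+1}=\prod_{j=i+1}^{k-1}\tilde\delta_{2^j-1}$ otherwise.
   Context: For a finite simple graph $G$, $i(G)$ is the number of independent sets of $G$ (sets of pairwise non-adjacent vertices), including the empty set. Pascal graph: $PG_n=G_n\left(\frac{1}{1-z},\frac{z}{1-z}\right)$ is the simple graph with vertex set $\{1,\ldots,n\}$ in which, for $i>j$, the vertices $i$ and $j$ are adjacent if and only if $[z^{i-2}]\frac{z^{j-1}}{(1-z)^j}\equiv1\pmod2$, where $[z^m]h$ denotes the coefficient of $z^m$ in $h$. Auxiliary numbers: for $n\ge 1$, let $\Delta_n$ and $\tilde\Delta_n$ be the graphs with vertex set $\{1,\ldots,n\}$ and edge sets $$E(\Delta_n)=\{i(i+1)\mid 1\le i<n\}\cup\{(2i-1)(2i+1)\mid 1\le i\le\lfloor(n-1)/2\rfloor\},$$ $$E(\tilde\Delta_n)=\{i(i+1)\mid 1\le i<n\}\cup\{(2i)(2i+2)\mid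 1\le i\le\lfloor(n-2)/2\rfloor\}.$$ Put $\delta_n=i(\Delta_n)$ and $\tilde\delta_n=i(\tilde\Delta_n)$ for $n\ge1$, and $\delta_0=\tilde\delta_0=1$. *)

theory Defs
  imports "HOL-Computational_Algebra.Formal_Power_Series"
begin

(* A graph is a pair (vertex set, edge set); an edge is the two-element set of its ends. *)
type_synonym 'a graph = "'a set \<times> 'a set set"

definition finite_simple_graph :: "'a graph \<Rightarrow> bool" where
  "finite_simple_graph G \<longleftrightarrow>
     finite (fst G) \<and> (\<forall>e\<in>snd G. e \<subseteq> fst G \<and> card e = 2)"

definition independent_set :: "'a graph \<Rightarrow> 'a set \<Rightarrow> bool" where
  "independent_set G S \<longleftrightarrow> S \<subseteq> fst G \<and> pairwise (\<lambda>x y. {x, y} \<notin> snd G) S"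

definition num_indep :: "'a graph \<Rightarrow> nat" where
  "num_indep G = card {S. independent_set G S}"

(* The series z^(j-1) / (1-z)^j has integer coefficients. It is taken over the rationals
   because division of power series needs inverses of coefficients. *)
definition pascal_adj :: "nat \<Rightarrow> nat \<Rightarrow> bool" where
  "pascal_adj i j \<longleftrightarrow>
     (\<exists>c::int. fps_nth (fps_X ^ (j - 1) / (1 - fps_X) ^ j :: rat fps) (i - 2) = of_int c
        \<and> c mod 2 = 1)"

definition pascal_graph :: "nat \<Rightarrow> nat graph" where
  "pascal_graph n = ({1..n}, {{i, j} | i j. 1 \<le> j \<and> j < i \<and> i \<le> n \<and> pascal_adj i j})"

definition Delta_graph :: "nat \<Rightarrow> nat graph" where
  "Delta_graph n = ({1..n},
     {{i, i + 1} | i. 1 \<le> i \<and> i < n} \<union>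
     {{2 * i - 1, 2 * i + 1} | i. 1 \<le> i \<and> i \<le> (n - 1) div 2})"

definition Delta_tilde_graph :: "nat \<Rightarrow> nat graph" where
  "Delta_tilde_graph n = ({1..n},
     {{i, i + 1} | i. 1 \<le> i \<and> i < n} \<union>
     {{2 * i, 2 * i + 2} | i. 1 \<le> i \<and> i \<le> (n - 2) div 2})"

definition delta :: "nat \<Rightarrow> int" where
  "delta n = (if n = 0 then 1 else int (num_indep (Delta_graph n)))"

(* Indexed by integers because the value is 1 also at negative indices. *)
definition delta_tilde :: "int \<Rightarrow> int" where
  "delta_tilde m = (if m \<le> 0 then 1 else int (num_indep (Delta_tilde_graph (nat m))))"

lemma fps_nth_pascal:
  "fps_nth (fps_X ^ m / (1 - fps_X) ^ Suc m :: rat fps) (m + r) = of_nat ((m + r) choose m)"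
proof -
  have "(fps_X ^ m / (1 - fps_X) ^ Suc m :: rat fps) = fps_X ^ m * inverse ((1 - fps_X) ^ Suc m)"
    by (rule fps_divide_unit) simp
  moreover have "fps_nth (inverse ((1 - fps_X) ^ Suc m) :: rat fps) r = of_nat ((m + r) choose m)"
    using one_minus_const_fps_X_neg_power'[of "Suc m" "1::rat"] binomial_symmetric[of m "m + r"]
    by (simp del: power_Suc binomial_Suc_Suc)
  ultimately show ?thesis
    by (simp del: power_Suc add: fps_X_power_mult_nth)
qed

lemma pascal_adj_iff_odd_choose:
  assumes "1 \<le> j" "j < i"
  shows "pascal_adj i j \<longleftrightarrow> odd ((i - 2) choose (j - 1))"
proof -
  define m r where "m = j - 1" and "r = i - 2 - m"
  have j: "j = Suc m" and i: "i - 2 = m + r"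
    using assms by (auto simp: m_def r_def)
  have "pascal_adj i j \<longleftrightarrow> (\<exists>c::int. (of_int c :: rat) = of_int (int ((m + r) choose m)) \<and> c mod 2 = 1)"
    unfolding pascal_adj_def j i diff_Suc_1 fps_nth_pascal by (metis of_int_of_nat_eq)
  also have "\<dots> \<longleftrightarrow> odd ((m + r) choose m)"
    unfolding of_int_eq_iff by (auto simp flip: odd_iff_mod_2_eq_one)
  finally show ?thesis by (simp add: i m_def)
qed

lemma finite_simple_graph_pascal_graph: "finite_simple_graph (pascal_graph n)"
  by (auto simp: finite_simple_graph_def pascal_graph_def card_2_iff)

lemma finite_simple_graph_Delta_graph: "finite_simple_graph (Delta_graph n)"
  by (auto simp: finite_simple_graph_def Delta_graph_def card_insert_if)

lemma finite_simple_graph_Delta_tilde_graph: "finite_simple_graph (Delta_tilde_graph n)"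
  by (auto simp: finite_simple_graph_def Delta_tilde_graph_def card_insert_if)

end

theory Submission
  imports Defs
begin

(* Delta_n is a subgraph of PG_n, so i(PG_n) <= delta_n, and the bound improves by every
   independent set of Delta_n that is dependent in PG_n. In PG_n each vertex 2^i + 1 is adjacent
   to all smaller vertices, the vertex 1 is adjacent to all others, and the neighbours of 2 are the
   odd vertices. The independent sets of Delta_n that contain 2^i + 1 and a smaller vertex, but no
   2^j + 1 with i < j <= k, are therefore all bad. Of those that avoid every 2^j + 1
   with 1 <= j <= k and contain 1 (respectively 2), at most 1 (respectively 2^(n/2 - 1)) are
   independent in PG_n. Deleting the vertices 2^j + 1 splits Delta_n into intervals without
   edges between them, which gives the products of delta_tilde values. *)

section \<open>Spaced sets: translation and multiplicativity of their number\<close>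

text \<open>The parameter \<open>c\<close> matters only through its parity: an even \<open>c\<close>
  describes independence in Delta_n, an odd \<open>c\<close> independence in the tilde graph. Having
  both in one predicate lets an interval of Delta_n turn into a tilde graph by translation.\<close>

definition spaced :: "nat \<Rightarrow> nat set \<Rightarrow> bool" where
  "spaced c S \<longleftrightarrow> (\<forall>x\<in>S. Suc x \<notin> S \<and> (odd (x + c) \<longrightarrow> x + 2 \<notin> S))"

definition spaced_subsets :: "nat \<Rightarrow> nat set \<Rightarrow> nat set set" where
  "spaced_subsets c A = {S. S \<subseteq> A \<and> spaced c S}"

lemma spaced_mono: "spaced c S \<Longrightarrow> T \<subseteq> S \<Longrightarrow> spaced c T"
  unfolding spaced_def by blast

lemma finite_spaced_subsets [simp]: "finite A \<Longrightarrow> finite (spaced_subsets c A)"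
  unfolding spaced_subsets_def by (rule finite_subset[of _ "Pow A"]) auto

lemma spaced_subsets_empty [simp]: "spaced_subsets c {} = {{}}"
  by (auto simp: spaced_subsets_def spaced_def)

lemma spaced_translate: "spaced c ((+) d ` S) \<longleftrightarrow> spaced (c + d) S"
proof -
  have "Suc (d + x) \<in> (+) d ` S \<longleftrightarrow> Suc x \<in> S" "d + x + 2 \<in> (+) d ` S \<longleftrightarrow> x + 2 \<in> S" for x
    by (auto simp: image_iff)
  moreover have "d + x + c = x + (c + d)" for x
    by simp
  ultimately show ?thesis
    by (simp only: spaced_def ball_simps)
qed

lemma card_spaced_subsets_translate:
  "card (spaced_subsets c ((+) d ` A)) = card (spaced_subsets (c + d) A)"
proof -
  have "spaced_subsets c ((+) d ` A) = (`) ((+) d) ` spaced_subsets (c + d) A"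
    by (auto simp: spaced_subsets_def subset_image_iff spaced_translate)
  moreover have "inj ((`) ((+) d))"
    by (simp add: inj_image_eq_iff inj_on_def)
  ultimately show ?thesis
    by (simp add: card_image inj_on_subset)
qed

text \<open>Only the vertex \<open>m + 1\<close> need be absent between \<open>A\<close> and
  \<open>B\<close>. The one pair across the cut at distance at most two is then \<open>m\<close>,
  \<open>m + 2\<close>, and since \<open>m + c\<close> is even this pair may occur together. Hence
  the choices in \<open>A\<close> and \<open>B\<close> are independent.\<close>

lemma card_spaced_subsets_Un:
  assumes "finite A" "finite B" "even (m + c)" "A \<subseteq> {..m}" "B \<subseteq> {m + 2..}"
  shows "card (spaced_subsets c (A \<union> B)) = card (spaced_subsets c A) * card (spaced_subsets c B)"
proof -
  have disj: "A \<inter> B = {}"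
    using assms by fastforce
  have spaced_Un: "spaced c (S \<union> T)" if "S \<subseteq> A" "T \<subseteq> B" "spaced c S" "spaced c T" for S T
  proof -
    have S: "x \<le> m" if "x \<in> S" for x using \<open>S \<subseteq> A\<close> assms(4) that by auto
    have T: "m + 2 \<le> x" if "x \<in> T" for x using \<open>T \<subseteq> B\<close> assms(5) that by auto
    have ST: "Suc x \<notin> T \<and> (odd (x + c) \<longrightarrow> x + 2 \<notin> T)" if "x \<in> S" for x
      using S[OF that] T[of "Suc x"] T[of "x + 2"] assms(3) by (cases "x = m") auto
    have TS: "Suc x \<notin> S \<and> x + 2 \<notin> S" if "x \<in> T" for x
      using T[OF that] S[of "Suc x"] S[of "x + 2"] by auto
    have "Suc x \<notin> S \<union> T \<and> (odd (x + c) \<longrightarrow> x + 2 \<notin> S \<union> T)" if "x \<in> S \<union> T" for x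
      using that ST[of x] TS[of x] \<open>spaced c S\<close> \<open>spaced c T\<close> unfolding spaced_def by blast
    then show ?thesis
      unfolding spaced_def by blast
  qed
  have "bij_betw (\<lambda>(S, T). S \<union> T) (spaced_subsets c A \<times> spaced_subsets c B) (spaced_subsets c (A \<union> B))"
  proof (rule bij_betw_byWitness[where f' = "\<lambda>U. (U \<inter> A, U \<inter> B)"])
    show "\<forall>p\<in>spaced_subsets c A \<times> spaced_subsets c B.
        ((case p of (S, T) \<Rightarrow> S \<union> T) \<inter> A, (case p of (S, T) \<Rightarrow> S \<union> T) \<inter> B) = p"
      using disj by (auto simp: spaced_subsets_def)
    show "\<forall>U\<in>spaced_subsets c (A \<union> B). (case (U \<inter> A, U \<inter> B) of (S, T) \<Rightarrow> S \<union> T) = U"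
      by (auto simp: spaced_subsets_def)
    show "(\<lambda>(S, T). S \<union> T) ` (spaced_subsets c A \<times> spaced_subsets c B) \<subseteq> spaced_subsets c (A \<union> B)"
      using spaced_Un by (auto simp: spaced_subsets_def)
    show "(\<lambda>U. (U \<inter> A, U \<inter> B)) ` spaced_subsets c (A \<union> B) \<subseteq> spaced_subsets c A \<times> spaced_subsets c B"
      by (auto simp: spaced_subsets_def intro: spaced_mono)
  qed
  from bij_betw_same_card[OF this] show ?thesis
    by (simp add: card_cartesian_product)
qed

section \<open>The numbers delta and tilde delta as counts of spaced sets\<close>

lemma independent_set_iff_spaced:
  assumes "\<And>x y. \<lbrakk>1 \<le> x; x < y; y \<le> n\<rbrakk> \<Longrightarrow> {x, y} \<in> E \<longleftrightarrow> y = Suc x \<or> odd (x + c) \<and> y = x + 2"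
  shows "independent_set ({1..n}, E) S \<longleftrightarrow> S \<subseteq> {1..n} \<and> spaced c S"
proof -
  have "pairwise (\<lambda>x y. {x, y} \<notin> E) S \<longleftrightarrow> spaced c S" if S: "S \<subseteq> {1..n}"
  proof
    assume *: "pairwise (\<lambda>x y. {x, y} \<notin> E) S"
    have "y \<noteq> Suc x \<and> \<not> (odd (x + c) \<and> y = x + 2)" if "x \<in> S" "y \<in> S" "x < y" for x y
      using assms[of x y] * that S by (auto simp: pairwise_def subset_iff)
    then show "spaced c S"
      unfolding spaced_def by (metis less_add_same_cancel1 lessI zero_less_numeral)
  next
    assume *: "spaced c S"
    have "{x, y} \<notin> E" if "x \<in> S" "y \<in> S" "x < y" for x y
      using assms[of x y] * that S by (auto simp: spaced_def subset_iff)
    then show "pairwise (\<lambda>x y. {x, y} \<notin> E) S"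
      unfolding pairwise_def by (metis insert_commute linorder_neqE_nat)
  qed
  then show ?thesis
    by (auto simp: independent_set_def)
qed

text \<open>The value 1 fixed at \<open>n = 0\<close> agrees with the single subset of the empty
  interval. For positive \<open>n\<close>, the distance-two edges are those starting at an odd
  vertex, which is the case \<open>c = 0\<close>.\<close>

lemma delta_eq_card: "delta n = int (card (spaced_subsets 0 {1..n}))"
proof (cases "n = 0")
  case False
  have "independent_set (Delta_graph n) S \<longleftrightarrow> S \<subseteq> {1..n} \<and> spaced 0 S" for S
    unfolding Delta_graph_def
  proof (rule independent_set_iff_spaced)
    fix x y assume xy: "1 \<le> x" "x < y" "y \<le> n"
    then have "(\<exists>i. x = 2 * i - 1 \<and> y = 2 * i + 1 \<and> 1 \<le> i \<and> i \<le> (n - 1) div 2) \<longleftrightarrow> odd x \<and> y = x + 2"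
    proof (intro iffI; clarify)
      fix i :: nat assume "1 \<le> i"
      then show "odd (2 * i - 1) \<and> 2 * i + 1 = 2 * i - 1 + 2"
        by (cases i) auto
    next
      assume "odd x" "y = x + 2"
      then obtain b where "x = 2 * b + 1" by (elim oddE)
      with \<open>y = x + 2\<close> xy
      show "\<exists>i. x = 2 * i - 1 \<and> x + 2 = 2 * i + 1 \<and> 1 \<le> i \<and> i \<le> (n - 1) div 2"
        by (intro exI[of _ "b + 1"]) simp
    qed
    with xy show "{x, y} \<in> {{i, i + 1} |i. 1 \<le> i \<and> i < n}
          \<union> {{2 * i - 1, 2 * i + 1} |i. 1 \<le> i \<and> i \<le> (n - 1) div 2}
        \<longleftrightarrow> y = Suc x \<or> odd (x + 0) \<and> y = x + 2"
      by (auto simp: doubleton_eq_iff)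
  qed
  then show ?thesis
    using False by (simp add: delta_def num_indep_def spaced_subsets_def)
qed (simp add: delta_def)

lemma delta_tilde_eq_card: "delta_tilde (int n) = int (card (spaced_subsets 1 {1..n}))"
proof (cases "n = 0")
  case False
  have "independent_set (Delta_tilde_graph n) S \<longleftrightarrow> S \<subseteq> {1..n} \<and> spaced 1 S" for S
    unfolding Delta_tilde_graph_def
  proof (rule independent_set_iff_spaced)
    fix x y assume xy: "1 \<le> x" "x < y" "y \<le> n"
    then have "(\<exists>i. x = 2 * i \<and> y = 2 * i + 2 \<and> 1 \<le> i \<and> i \<le> (n - 2) div 2) \<longleftrightarrow> even x \<and> y = x + 2"
      by (auto elim!: evenE)
    with xy show "{x, y} \<in> {{i, i + 1} |i. 1 \<le> i \<and> i < n}
          \<union> {{2 * i, 2 * i + 2} |i. 1 \<le> i \<and> i \<le> (n - 2) div 2}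
        \<longleftrightarrow> y = Suc x \<or> odd (x + 1) \<and> y = x + 2"
      by (auto simp: doubleton_eq_iff)
  qed
  then show ?thesis
    using False by (simp add: delta_tilde_def num_indep_def spaced_subsets_def)
qed (simp add: delta_tilde_def)

lemma spaced_parity: "odd c \<Longrightarrow> spaced c = spaced 1"
  by (auto simp: spaced_def fun_eq_iff)

text \<open>Shifting the interval down by the odd number \<open>a - 1\<close> exchanges the
  parities, so Delta_n restricted to it is a tilde graph. For \<open>b < a\<close> the interval is
  empty and the argument of \<open>delta_tilde\<close> is at most 0, so both sides are 1; this is
  where the convention for negative indices enters.\<close>

lemma card_spaced_subsets_even_interval:
  assumes "even a" "0 < a"
  shows "int (card (spaced_subsets 0 {a..b})) = delta_tilde (int b - int a + 1)"
proof (cases "a \<le> b")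
  case True
  define m where "m = b + 1 - a"
  have "{a..b} = (+) (a - 1) ` {1..m}"
    using True assms by (cases a) (simp_all add: m_def Suc_diff_le del: One_nat_def)
  moreover have "int b - int a + 1 = int m"
    using True by (simp add: m_def)
  moreover have "spaced_subsets (a - 1) {1..m} = spaced_subsets 1 {1..m}"
    using assms spaced_parity[of "a - 1"] by (simp add: spaced_subsets_def)
  ultimately show ?thesis
    by (simp add: card_spaced_subsets_translate delta_tilde_eq_card del: image_add_atLeastAtMost)
qed (simp add: delta_tilde_def)

section \<open>Binomial parity and adjacency in the Pascal graph\<close>

text \<open>The inner entries of row 2^k of Pascal's triangle are even, so by Pascal's rule
  neighbouring entries of row 2^k - 1 have equal parity, and the first of them is 1. If an inner
  entry in column j + 1 were odd, absorption would make 2^k divide j + 1 < 2^k.\<close>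

lemma odd_choose_two_power_minus_one:
  assumes "j < 2 ^ k"
  shows "odd ((2 ^ k - 1) choose j)"
  using assms
proof (induction j)
  case (Suc j)
  have "even (2 ^ k choose Suc j)"
  proof (rule ccontr)
    assume "odd (2 ^ k choose Suc j)"
    then have "coprime ((2::nat) ^ k) (2 ^ k choose Suc j)"
      by simp
    moreover have "2 ^ k dvd Suc j * (2 ^ k choose Suc j)"
      by (simp only: binomial_absorption dvd_triv_left)
    ultimately have "2 ^ k dvd Suc j"
      using coprime_dvd_mult_left_iff by blast
    then show False
      using Suc.prems by (meson dvd_imp_le not_le zero_less_Suc)
  qed
  moreover have "2 ^ k choose Suc j = ((2 ^ k - 1) choose j) + ((2 ^ k - 1) choose Suc j)"
    using choose_reduce_nat[of "2 ^ k" "Suc j"] by simp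
  ultimately show ?case
    using Suc by simp
qed simp

lemma pascal_adj_first: "1 < i \<Longrightarrow> pascal_adj i 1"
  by (subst pascal_adj_iff_odd_choose) auto

lemma pascal_adj_second: "2 < i \<Longrightarrow> pascal_adj i 2 \<longleftrightarrow> odd i"
  by (subst pascal_adj_iff_odd_choose) auto

lemma pascal_adj_two_power:
  assumes "1 \<le> j" "j \<le> 2 ^ i"
  shows "pascal_adj (2 ^ i + 1) j"
  using assms odd_choose_two_power_minus_one[of "j - 1" i]
  by (subst pascal_adj_iff_odd_choose) (auto simp: numeral_2_eq_2)

text \<open>The coefficient is C(j-1, j-1) = 1, and for distance two it is C(j, j-1) = j. Together
  these two adjacencies give all edges of Delta_n.\<close>

lemma pascal_adj_Suc: "1 \<le> j \<Longrightarrow> pascal_adj (Suc j) j"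
  by (subst pascal_adj_iff_odd_choose) (auto simp: numeral_2_eq_2)

lemma pascal_adj_add_two: "odd j \<Longrightarrow> pascal_adj (j + 2) j"
  by (subst pascal_adj_iff_odd_choose) (auto simp: binomial_symmetric[of "j - 1" j] elim: oddE)

section \<open>Independent sets of the Pascal graph\<close>

lemma independent_pascalD:
  assumes "independent_set (pascal_graph n) S" "i \<in> S" "j \<in> S" "j < i"
  shows "\<not> pascal_adj i j"
proof
  assume "pascal_adj i j"
  then have "{i, j} \<in> snd (pascal_graph n)"
    using assms by (fastforce simp: pascal_graph_def independent_set_def)
  then show False
    using assms by (auto simp: independent_set_def pairwise_def)
qed

lemma independent_pascal_imp_spaced:
  assumes "independent_set (pascal_graph n) S"
  shows "S \<in> spaced_subsets 0 {1..n}"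
proof -
  have S: "S \<subseteq> {1..n}"
    using assms by (simp add: independent_set_def pascal_graph_def)
  have "Suc x \<notin> S \<and> (odd x \<longrightarrow> x + 2 \<notin> S)" if "x \<in> S" for x
    using independent_pascalD[OF assms, of "Suc x" x] independent_pascalD[OF assms, of "x + 2" x]
      pascal_adj_Suc[of x] pascal_adj_add_two[of x] S that by auto
  with S show ?thesis
    by (simp add: spaced_subsets_def spaced_def)
qed

text \<open>Vertex 2 is adjacent to 1 and to every larger odd vertex, so the other members are among
  the even numbers 4, 6, ... up to \<open>n\<close>, of which there are
  \<open>n div 2 - 1\<close>.\<close>

lemma card_independent_pascal_with_second:
  assumes "2 \<le> n"
  shows "card {S. independent_set (pascal_graph n) S \<and> 2 \<in> S} \<le> 2 ^ (n div 2 - 1)"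
proof -
  let ?E = "(*) 2 ` {2..n div 2}"
  have "{S. independent_set (pascal_graph n) S \<and> 2 \<in> S} \<subseteq> insert 2 ` Pow ?E"
  proof
    fix S assume "S \<in> {S. independent_set (pascal_graph n) S \<and> 2 \<in> S}"
    then have ind: "independent_set (pascal_graph n) S" and 2: "2 \<in> S" by auto
    have "x \<in> ?E" if "x \<in> S - {2}" for x
    proof -
      have x: "1 \<le> x" "x \<le> n"
        using that ind by (auto simp: independent_set_def pascal_graph_def)
      have "x \<noteq> 1"
        using independent_pascalD[OF ind 2, of x] pascal_adj_first[of 2] that by auto
      with x that have "2 < x" by auto
      moreover have "even x"
        using independent_pascalD[OF ind _ 2, of x] pascal_adj_second[of x] that \<open>2 < x\<close> by auto
      ultimately show ?thesis
        using x by (auto elim!: evenE)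
    qed
    then show "S \<in> insert 2 ` Pow ?E"
      using 2 by (intro image_eqI[of _ _ "S - {2}"]) auto
  qed
  then have "card {S. independent_set (pascal_graph n) S \<and> 2 \<in> S} \<le> card (insert 2 ` Pow ?E)"
    by (intro card_mono) auto
  also have "\<dots> \<le> card (Pow ?E)"
    by (intro card_image_le) auto
  also have "\<dots> = 2 ^ (n div 2 - 1)"
    by (simp add: card_Pow card_image inj_on_def)
  finally show ?thesis .
qed

lemma independent_pascal_with_first:
  assumes "independent_set (pascal_graph n) S" "1 \<in> S"
  shows "S = {1}"
proof -
  have "x = 1" if "x \<in> S" for x
    using independent_pascalD[OF assms(1) that assms(2)] pascal_adj_first[of x] that assms(1)
    by (force simp: independent_set_def pascal_graph_def)
  with assms(2) show ?thesis by blast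
qed

section \<open>Families of bad sets and their sizes\<close>

lemma spaced_insert:
  assumes "spaced c S" "S \<subseteq> {..<v - 2} \<union> {v + 2<..}"
  shows "spaced c (insert v S)"
proof -
  have "v + 2 < x \<or> x < v - 2" if "x \<in> S" for x
    using assms(2) that by auto
  then show ?thesis
    using assms(1) by (fastforce simp: spaced_def)
qed

lemma card_insert_image:
  assumes "\<And>S. S \<in> F \<Longrightarrow> v \<notin> S"
  shows "card (insert v ` F) = card F"
  using assms by (intro card_image inj_onI) (metis insert_ident)

context
  fixes n k :: nat
begin

text \<open>The vertices strictly between the consecutive deleted vertices \<open>2 ^ j + 1\<close>
  and \<open>2 ^ (j + 1) + 1\<close>, cut off at \<open>n\<close>. For \<open>j \<ge> 1\<close> the
  block starts at an even number, so it is counted by \<open>delta_tilde\<close>.\<close>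

definition gap :: "nat \<Rightarrow> nat set" where
  "gap j = {2 ^ j + 2..min n (2 ^ (j + 1))}"

definition gaps_from :: "nat \<Rightarrow> nat set" where
  "gaps_from i = (\<Union>j\<in>{i..k}. gap j)"

text \<open>The bounds omit \<open>2 ^ i - 1\<close>, \<open>2 ^ i\<close>, \<open>2 ^ i + 2\<close>
  and \<open>2 ^ i + 3\<close>, the possible neighbours of \<open>2 ^ i + 1\<close> in Delta_n. The
  difference of families demands a member below \<open>2 ^ i + 1\<close>, while the gaps exclude
  every later \<open>2 ^ j + 1\<close> with \<open>j \<le> k\<close>. Earlier ones remain
  allowed.\<close>

definition bad_with_power :: "nat \<Rightarrow> nat set set" where
  "bad_with_power i = insert (2 ^ i + 1) `
     (spaced_subsets 0 ({1..2 ^ i - 2} \<union> ({2 ^ i + 4..min n (2 ^ (i + 1))} \<union> gaps_from (i + 1)))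
      - spaced_subsets 0 ({2 ^ i + 4..min n (2 ^ (i + 1))} \<union> gaps_from (i + 1)))"

lemma finite_gaps_from [simp]: "finite (gaps_from i)"
  by (simp add: gaps_from_def gap_def)

lemma gaps_from_ge: "gaps_from i \<subseteq> {2 ^ i + 2..}"
proof
  fix x assume "x \<in> gaps_from i"
  then obtain j where "i \<le> j" "2 ^ j + 2 \<le> x"
    by (auto simp: gaps_from_def gap_def)
  moreover have "(2::nat) ^ i \<le> 2 ^ j"
    using \<open>i \<le> j\<close> by simp
  ultimately have "2 ^ i + 2 \<le> x"
    by linarith
  then show "x \<in> {2 ^ i + 2..}"
    by (simp only: atLeast_iff)
qed

lemma gaps_from_le: "gaps_from i \<subseteq> {..n}"
  by (auto simp: gaps_from_def gap_def)

lemma two_power_notin_gaps_from: "2 ^ j + 1 \<notin> gaps_from i"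
proof
  assume "2 ^ j + 1 \<in> gaps_from i"
  then obtain l where l: "2 ^ l + 2 \<le> (2::nat) ^ j + 1" "2 ^ j + 1 \<le> (2::nat) ^ (l + 1)"
    by (auto simp: gaps_from_def gap_def)
  have "(2::nat) ^ l < 2 ^ j" "(2::nat) ^ j < 2 ^ (l + 1)"
    using l by linarith+
  then have "l < j" "j < l + 1"
    by (simp_all only: power_strict_increasing_iff one_less_numeral_iff semiring_norm)
  then show False by simp
qed

text \<open>Downward induction splits off the lowest gap. The missing vertex
  \<open>2 ^ (i + 1) + 1\<close> separates it from the rest, and the cut is admissible because
  \<open>2 ^ (i + 1)\<close> is even.\<close>

lemma card_spaced_subsets_gaps_from:
  assumes "1 \<le> i" "i \<le> k + 1"
  shows "int (card (spaced_subsets 0 (gaps_from i))) =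
    (\<Prod>j = i..k. delta_tilde (int (min n (2 ^ (j + 1))) - 2 ^ j - 1))"
  using assms(2,1)
proof (induction i rule: inc_induct)
  case base
  then show ?case by (simp add: gaps_from_def)
next
  case (step i)
  then have i: "{i..k} = insert i {Suc i..k}"
    by auto
  have "gaps_from i = gap i \<union> gaps_from (Suc i)"
    unfolding gaps_from_def i by simp
  moreover have "gap i \<subseteq> {..2 ^ (i + 1)}"
    by (auto simp: gap_def)
  ultimately have "card (spaced_subsets 0 (gaps_from i)) =
      card (spaced_subsets 0 (gap i)) * card (spaced_subsets 0 (gaps_from (Suc i)))"
    using card_spaced_subsets_Un[of "gap i" "gaps_from (Suc i)" "2 ^ (i + 1)" 0] gaps_from_ge[of "Suc i"]
    by (simp add: gap_def)
  moreover have "int (card (spaced_subsets 0 (gap i))) =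
      delta_tilde (int (min n (2 ^ (i + 1))) - 2 ^ i - 1)"
    unfolding gap_def using step.prems by (subst card_spaced_subsets_even_interval) (auto simp: algebra_simps)
  ultimately show ?case
    using step unfolding i by simp
qed

text \<open>The lower part, the shortened gap and the later gaps contribute independent factors. The
  -1 removes the empty choice in the lower part, which would leave \<open>2 ^ i + 1\<close> without
  a smaller companion.\<close>

lemma card_bad_with_power:
  assumes "1 \<le> i" "i \<le> k"
  shows "int (card (bad_with_power i)) = (delta (2 ^ i - 2) - 1) *
    delta_tilde (int (min n (2 ^ (i + 1))) - 2 ^ i - 3) *
    (\<Prod>j = i + 1..k. delta_tilde (int (min n (2 ^ (j + 1))) - 2 ^ j - 1))"
proof -
  define A where "A = {1..(2::nat) ^ i - 2}"
  define C where "C = {2 ^ i + 4..min n (2 ^ (i + 1))}"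
  define V where "V = C \<union> gaps_from (i + 1)"
  have two: "(2::nat) \<le> 2 ^ i"
    using power_increasing[of 1 i "2::nat"] assms by simp
  have gf: "gaps_from (i + 1) \<subseteq> {2 * 2 ^ i + 2..}"
    using gaps_from_ge[of "i + 1"] by simp
  have fin: "finite A" "finite C" "finite V"
    by (simp_all add: A_def C_def V_def)
  \<comment> \<open>The later gaps start at 2^(i+1) + 2, which is at least 2^i + 4 because 2^i is at
    least 2.\<close>
  have V: "V \<subseteq> {2 ^ i + 4..}"
    using gf two by (auto simp: V_def C_def)
  have AV: "card (spaced_subsets 0 (A \<union> V)) = card (spaced_subsets 0 A) * card (spaced_subsets 0 V)"
    using V fin assms by (intro card_spaced_subsets_Un[where m = "2 ^ i - 2"]) (auto simp: A_def)
  have CW: "card (spaced_subsets 0 V) = card (spaced_subsets 0 C) * card (spaced_subsets 0 (gaps_from (i + 1)))"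
    unfolding V_def using gf fin assms
    by (intro card_spaced_subsets_Un[where m = "2 * 2 ^ i"]) (auto simp: C_def)
  have sub: "spaced_subsets 0 V \<subseteq> spaced_subsets 0 (A \<union> V)"
    by (auto simp: spaced_subsets_def)
  have "bad_with_power i = insert (2 ^ i + 1) ` (spaced_subsets 0 (A \<union> V) - spaced_subsets 0 V)"
    by (simp add: bad_with_power_def A_def V_def C_def)
  also have "card \<dots> = card (spaced_subsets 0 (A \<union> V) - spaced_subsets 0 V)"
  proof (rule card_insert_image)
    have "2 ^ i + 1 \<notin> A \<union> V" using V by (auto simp: A_def)
    then show "2 ^ i + 1 \<notin> S" if "S \<in> spaced_subsets 0 (A \<union> V) - spaced_subsets 0 V" for S
      using that by (auto simp: spaced_subsets_def)
  qed
  also have "\<dots> = card (spaced_subsets 0 (A \<union> V)) - card (spaced_subsets 0 V)"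
    using sub fin by (simp add: card_Diff_subset)
  finally have "int (card (bad_with_power i)) =
      int (card (spaced_subsets 0 (A \<union> V))) - int (card (spaced_subsets 0 V))"
    using sub fin by (simp add: of_nat_diff card_mono)
  also have "\<dots> = (delta (2 ^ i - 2) - 1) * int (card (spaced_subsets 0 C))
      * int (card (spaced_subsets 0 (gaps_from (i + 1))))"
    unfolding AV CW delta_eq_card A_def[symmetric] by (simp add: algebra_simps)
  also have "int (card (spaced_subsets 0 C)) = delta_tilde (int (min n (2 ^ (i + 1))) - 2 ^ i - 3)"
    unfolding C_def using assms by (subst card_spaced_subsets_even_interval) (auto simp: algebra_simps)
  also have "int (card (spaced_subsets 0 (gaps_from (i + 1)))) =
      (\<Prod>j = i + 1..k. delta_tilde (int (min n (2 ^ (j + 1))) - 2 ^ j - 1))"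
    using assms by (intro card_spaced_subsets_gaps_from) auto
  finally show ?thesis .
qed

text \<open>The first two facts force dependence in the Pascal graph, the third places the set among
  those counted by \<open>delta n\<close>, and the first and fourth together make the families for
  different \<open>i\<close> disjoint.\<close>

lemma bad_with_powerE:
  assumes "S \<in> bad_with_power i" "1 \<le> i" "i \<le> k" "2 ^ k < n"
  shows "2 ^ i + 1 \<in> S" "\<exists>x\<in>S. 1 \<le> x \<and> x \<le> 2 ^ i" "S \<in> spaced_subsets 0 {1..n}"
    "\<And>j. i < j \<Longrightarrow> 2 ^ j + 1 \<notin> S"
proof -
  define A where "A = {1..(2::nat) ^ i - 2}"
  define C where "C = {2 ^ i + 4..min n (2 ^ (i + 1))}"
  define V where "V = C \<union> gaps_from (i + 1)"
  obtain T where T: "T \<subseteq> A \<union> V" "spaced 0 T" "\<not> T \<subseteq> V" and S: "S = insert (2 ^ i + 1) T"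
    using assms(1) by (auto simp: bad_with_power_def spaced_subsets_def A_def V_def C_def)
  have two: "(2::nat) \<le> 2 ^ i"
    using power_increasing[of 1 i "2::nat"] assms by simp
  have "(2::nat) ^ i \<le> 2 ^ k"
    using assms by simp
  then have le: "2 ^ i < n"
    using assms(4) by linarith
  have V: "V \<subseteq> {2 ^ i + 4..n}"
  proof
    fix x assume "x \<in> V"
    then show "x \<in> {2 ^ i + 4..n}"
      using subsetD[OF gaps_from_ge[of "i + 1"], of x] subsetD[OF gaps_from_le[of "i + 1"], of x] two
      by (auto simp: V_def C_def)
  qed
  show "2 ^ i + 1 \<in> S"
    by (simp add: S)
  obtain x where "x \<in> T" "x \<in> A"
    using T by auto
  then show "\<exists>x\<in>S. 1 \<le> x \<and> x \<le> 2 ^ i"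
    by (auto simp: S A_def intro!: bexI[of _ x])
  have "T \<subseteq> {..<2 ^ i + 1 - 2} \<union> {2 ^ i + 1 + 2<..}"
  proof
    fix y assume "y \<in> T"
    then have "y \<in> A \<or> y \<in> V" using T by blast
    then show "y \<in> {..<2 ^ i + 1 - 2} \<union> {2 ^ i + 1 + 2<..}"
      using V by (auto simp: A_def)
  qed
  then have "spaced 0 S"
    unfolding S by (intro spaced_insert T(2))
  moreover have "S \<subseteq> {1..n}"
  proof
    fix y assume "y \<in> S"
    then have "y = 2 ^ i + 1 \<or> y \<in> A \<or> y \<in> V" using T S by blast
    then show "y \<in> {1..n}"
      using V le by (auto simp: A_def)
  qed
  ultimately show "S \<in> spaced_subsets 0 {1..n}"
    by (simp add: spaced_subsets_def)
  show "2 ^ j + 1 \<notin> S" if "i < j" for j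
  proof -
    have "(2::nat) ^ (i + 1) \<le> 2 ^ j"
      using that by (intro power_increasing) auto
    then show ?thesis
      using T(1) two_power_notin_gaps_from[of j "i + 1"] by (auto simp: S A_def V_def C_def)
  qed
qed

lemma bad_with_power_not_independent:
  assumes "S \<in> bad_with_power i" "1 \<le> i" "i \<le> k" "2 ^ k < n"
  shows "\<not> independent_set (pascal_graph n) S"
proof
  assume ind: "independent_set (pascal_graph n) S"
  obtain x where "x \<in> S" "1 \<le> x" "x \<le> 2 ^ i"
    using bad_with_powerE(2)[OF assms] by blast
  with independent_pascalD[OF ind bad_with_powerE(1)[OF assms], of x] pascal_adj_two_power[of x i]
  show False by simp
qed

text \<open>The cases of vertex 1 and vertex 2 are treated together; \<open>3 - v\<close> is the
  other of the two. The gaps start at 4, so none of 1, 2, 3 lies in them.\<close>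

lemma insert_gaps_from_one:
  assumes "v = 1 \<or> v = 2" "S \<in> insert v ` spaced_subsets 0 (gaps_from 1)" "2 \<le> n"
  shows "v \<in> S" "3 - v \<notin> S" "S \<in> spaced_subsets 0 {1..n}" "\<And>j. 1 \<le> j \<Longrightarrow> 2 ^ j + 1 \<notin> S"
proof -
  obtain T where T: "T \<subseteq> gaps_from 1" "spaced 0 T" and S: "S = insert v T"
    using assms by (auto simp: spaced_subsets_def)
  have gf: "gaps_from 1 \<subseteq> {4..n}"
    using gaps_from_ge[of 1] gaps_from_le[of 1] by auto
  show "v \<in> S"
    by (simp add: S)
  show "3 - v \<notin> S"
    using assms(1) T gf by (auto simp: S)
  \<comment> \<open>For \<open>v = 2\<close> the vertex 4 may belong to \<open>T\<close>, since the
    distance-two edges of Delta_n join odd vertices only.\<close>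
  have ev: "Suc v \<notin> T" "odd v \<longrightarrow> v + 2 \<notin> T" "\<forall>x\<in>T. v < x"
    using assms(1) T gf by (auto simp: numeral_2_eq_2 numeral_3_eq_3)
  have "spaced 0 S"
    using T(2) ev unfolding S spaced_def by auto
  then show "S \<in> spaced_subsets 0 {1..n}"
    using T gf assms by (auto simp: spaced_subsets_def S)
  show "2 ^ j + 1 \<notin> S" if "1 \<le> j" for j
  proof -
    have "(2::nat) \<le> 2 ^ j"
      using power_increasing[of 1 j "2::nat"] that by simp
    then show ?thesis
      using T two_power_notin_gaps_from[of j 1] assms(1) by (auto simp: S)
  qed
qed

section \<open>The counting inequality\<close>

text \<open>Inside the family \<open>Y\<close> counted by \<open>delta n\<close>, the families
  \<open>P\<close>, \<open>Q 1\<close>, \<open>Q 2\<close> and the part of \<open>X\<close> outside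
  \<open>Q 1\<close> and \<open>Q 2\<close> are pairwise disjoint. The part of \<open>X\<close> lost
  in this way has at most 1 member in \<open>Q 1\<close> and at most
  \<open>2 ^ (n div 2 - 1)\<close> in \<open>Q 2\<close>. All terms are added, so that no truncated
  subtraction of families occurs.\<close>

lemma num_indep_pascal_le:
  assumes "2 \<le> n" "1 \<le> k" "2 ^ k < n"
  shows "num_indep (pascal_graph n) + (\<Sum>i = 1..k. card (bad_with_power i))
      + 2 * card (spaced_subsets 0 (gaps_from 1))
    \<le> card (spaced_subsets 0 {1..n}) + 1 + 2 ^ (n div 2 - 1)"
proof -
  define X where "X = {S. independent_set (pascal_graph n) S}"
  define Y where "Y = spaced_subsets 0 {1..n}"
  define P where "P = (\<Union>i\<in>{1..k}. bad_with_power i)"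
  define Q where "Q v = insert v ` spaced_subsets 0 (gaps_from 1)" for v
  note bad = bad_with_powerE[OF _ _ _ assms(3)]
  have fin: "finite Y"
    by (simp add: Y_def)
  have XY: "X \<subseteq> Y"
    using independent_pascal_imp_spaced by (auto simp: X_def Y_def)
  have PY: "P \<subseteq> Y"
    using bad(3) by (auto simp: P_def Y_def)
  have Q: "v \<in> S" "3 - v \<notin> S" "S \<in> Y" "1 \<le> j \<Longrightarrow> 2 ^ j + 1 \<notin> S"
    if "v = 1 \<or> v = 2" "S \<in> Q v" for v S j
    using insert_gaps_from_one[OF that(1) _ assms(1), of S] that(2) by (auto simp: Q_def Y_def)
  have XP: "X \<inter> P = {}"
    using bad_with_power_not_independent[OF _ _ _ assms(3)] by (auto simp: X_def P_def)
  \<comment> \<open>A member of \<open>P\<close> contains some \<open>2 ^ i + 1\<close> with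
    \<open>i \<ge> 1\<close>, a member of \<open>Q v\<close> contains none.\<close>
  have PQ: "P \<inter> Q v = {}" if v: "v = 1 \<or> v = 2" for v
    using bad(1) Q(4)[OF v] by (fastforce simp: P_def)
  have Q12: "Q 1 \<inter> Q 2 = {}"
    using Q(1)[of 2] Q(2)[of 1] by fastforce
  have "card P = (\<Sum>i = 1..k. card (bad_with_power i))"
    unfolding P_def
  proof (rule card_UN_disjoint)
    show "\<forall>i\<in>{1..k}. finite (bad_with_power i)"
      by (simp add: bad_with_power_def)
    \<comment> \<open>The larger index decides: \<open>2 ^ j + 1\<close> lies in every member of the
      second family and in no member of the first.\<close>
    have "bad_with_power i \<inter> bad_with_power j = {}" if "1 \<le> i" "i < j" "j \<le> k" for i j
      using bad(1)[of _ j] bad(4)[of _ i j] that by fastforce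
    then show "\<forall>i\<in>{1..k}. \<forall>j\<in>{1..k}. i \<noteq> j \<longrightarrow> bad_with_power i \<inter> bad_with_power j = {}"
      by (metis Int_commute atLeastAtMost_iff linorder_neqE_nat)
  qed simp
  moreover have cQ: "card (Q v) = card (spaced_subsets 0 (gaps_from 1))" if "v = 1 \<or> v = 2" for v
    unfolding Q_def
  proof (rule card_insert_image)
    show "v \<notin> S" if "S \<in> spaced_subsets 0 (gaps_from 1)" for S
      using that \<open>v = 1 \<or> v = 2\<close> gaps_from_ge[of 1] by (force simp: spaced_subsets_def)
  qed
  moreover have "card (P \<union> Q 1 \<union> Q 2) = card P + card (Q 1) + card (Q 2)"
  proof -
    have "finite P" "finite (Q 1)" "finite (Q 2)"
      using PY Q(3)[of 1] Q(3)[of 2] fin by (blast intro: finite_subset)+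
    then show ?thesis
      using PQ[of 1] PQ[of 2] Q12 by (subst card_Un_disjoint | blast | simp)+
  qed
  moreover have "card (X - (Q 1 \<union> Q 2)) + card (P \<union> Q 1 \<union> Q 2) \<le> card Y"
  proof -
    have "P \<union> Q 1 \<union> Q 2 \<subseteq> Y" "X - (Q 1 \<union> Q 2) \<subseteq> Y"
      using PY Q(3)[of 1] Q(3)[of 2] XY by blast+
    moreover have "(X - (Q 1 \<union> Q 2)) \<inter> (P \<union> Q 1 \<union> Q 2) = {}"
      using XP by blast
    ultimately show ?thesis
      using fin by (metis Un_least card_Un_disjoint card_mono finite_subset)
  qed
  moreover have "card X \<le> card (X - (Q 1 \<union> Q 2)) + card (X \<inter> Q 1) + card (X \<inter> Q 2)"
  proof -
    have "X = (X - (Q 1 \<union> Q 2)) \<union> (X \<inter> Q 1) \<union> (X \<inter> Q 2)"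
      by blast
    then have "card X = card \<dots>"
      by (rule arg_cong)
    also have "\<dots> \<le> card ((X - (Q 1 \<union> Q 2)) \<union> (X \<inter> Q 1)) + card (X \<inter> Q 2)"
      by (rule card_Un_le)
    also have "\<dots> \<le> card (X - (Q 1 \<union> Q 2)) + card (X \<inter> Q 1) + card (X \<inter> Q 2)"
      by (intro add_right_mono card_Un_le)
    finally show ?thesis .
  qed
  moreover have "card (X \<inter> Q 1) \<le> 1"
  proof -
    have "X \<inter> Q 1 \<subseteq> {{1}}"
      using independent_pascal_with_first[of n] Q(1)[of 1] by (auto simp: X_def)
    then have "card (X \<inter> Q 1) \<le> card {{1::nat}}"
      by (intro card_mono) auto
    then show ?thesis by simp
  qed
  moreover have "card (X \<inter> Q 2) \<le> 2 ^ (n div 2 - 1)"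
  proof -
    have "X \<inter> Q 2 \<subseteq> {S. independent_set (pascal_graph n) S \<and> 2 \<in> S}"
      using Q(1)[of 2] by (auto simp: X_def)
    moreover have "finite {S. independent_set (pascal_graph n) S \<and> 2 \<in> S}"
      by (rule finite_subset[OF _ fin]) (use XY in \<open>auto simp: X_def\<close>)
    ultimately show ?thesis
      using card_independent_pascal_with_second[OF assms(1)] by (meson card_mono le_trans)
  qed
  ultimately show ?thesis
    using cQ[of 1] cQ[of 2] unfolding num_indep_def X_def[symmetric] Y_def[symmetric] by simp
qed

end

section \<open>Evaluation of the factors for 2^k < n \<le> 2^(k+1)\<close>

theorem theorem3p7:
  fixes k n :: nat
  assumes "2 \<le> k" and "2 ^ k < n" and "n \<le> 2 ^ (k + 1)"
  shows "int (num_indep (pascal_graph n)) \<le>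
    delta n + 1 + 2 ^ (n div 2 - 1)
    - (delta (2 ^ k - 2) - 1) * delta_tilde (int n - 2 ^ k - 3)
    - delta_tilde (int n - 2 ^ k - 1) *
      (2 * (\<Prod>i = 1..k - 1. delta_tilde (2 ^ i - 1))
       + (\<Sum>i = 1..k - 1. (delta (2 ^ i - 2) - 1) * delta_tilde (2 ^ i - 3) *
            (if i = k - 1 then 1 else \<Prod>j = i + 1..k - 1. delta_tilde (2 ^ j - 1))))"
proof -
  \<comment> \<open>Only the last gap is cut off at \<open>n\<close>; \<open>a\<close> is its
    factor. The gaps below it are complete, with 2^j - 1 vertices each, and \<open>f\<close>
    multiplies their factors. In \<open>g\<close>, the lower part is combined with the shortened
    gap.\<close>
  define a where "a = delta_tilde (int n - 2 ^ k - 1)"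
  define f where "f i = (\<Prod>j = i..k - 1. delta_tilde (2 ^ j - 1))" for i
  define g where "g i = (delta (2 ^ i - 2) - 1) * delta_tilde (2 ^ i - 3)" for i
  have min_k: "min n (2 ^ (k + 1)) = n"
    using assms by simp
  have min_j: "min n (2 ^ (j + 1)) = 2 ^ (j + 1)" if "j < k" for j
  proof -
    have "(2::nat) ^ (j + 1) \<le> 2 ^ k"
      using that by (intro power_increasing) auto
    then show ?thesis using assms by simp
  qed
  have min_int: "int (min n (2 ^ (j + 1))) - 2 ^ j = 2 ^ j" if "j < k" for j
    by (subst min_j[OF that]) simp
  have prod: "(\<Prod>j = i..k. delta_tilde (int (min n (2 ^ (j + 1))) - 2 ^ j - 1)) = f i * a"
    if "i \<le> k" for i
  proof -
    have "{i..k} = insert k {i..k - 1}" "k \<notin> {i..k - 1}"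
      using that assms(1) by auto
    moreover have "(\<Prod>j = i..k - 1. delta_tilde (int (min n (2 ^ (j + 1))) - 2 ^ j - 1)) = f i"
      unfolding f_def using assms(1) by (intro prod.cong) (auto simp only: min_int atLeastAtMost_iff)
    ultimately show ?thesis
      using min_k by (simp add: a_def mult.commute)
  qed
  \<comment> \<open>No gap follows the one of index \<open>k\<close>, so the product is empty and
    this term stands apart without the factor \<open>a\<close>.\<close>
  have bad_k: "int (card (bad_with_power n k k)) =
      (delta (2 ^ k - 2) - 1) * delta_tilde (int n - 2 ^ k - 3)"
    using card_bad_with_power[of k k n] assms(1) min_k by simp
  have bad_i: "int (card (bad_with_power n k i)) = g i * f (i + 1) * a" if "1 \<le> i" "i < k" for i
    using card_bad_with_power[of i k n] that by (simp only: prod min_int g_def)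
  have "(\<Sum>i = 1..k - 1. int (card (bad_with_power n k i))) = (\<Sum>i = 1..k - 1. g i * f (i + 1) * a)"
    using assms(1) by (intro sum.cong refl bad_i) auto
  moreover have "{1..k} = insert k {1..k - 1}" "k \<notin> {1..k - 1}"
    using assms(1) by auto
  ultimately have "(\<Sum>i = 1..k. int (card (bad_with_power n k i))) =
      (delta (2 ^ k - 2) - 1) * delta_tilde (int n - 2 ^ k - 3)
      + (\<Sum>i = 1..k - 1. g i * f (i + 1) * a)"
    using bad_k by simp
  moreover have "int (card (spaced_subsets 0 (gaps_from n k 1))) = f 1 * a"
    using card_spaced_subsets_gaps_from[of 1 k n] prod[of 1] assms(1) by simp
  moreover have "2 \<le> n" "1 \<le> k"
    using assms power_increasing[of 1 k "2::nat"] by auto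
  \<comment> \<open>At \<open>i = k - 1\<close> the value \<open>f k\<close> is a product over the
    empty range from \<open>k\<close> to \<open>k - 1\<close>, hence 1, so the case distinction
    agrees with the uniform formula.\<close>
  moreover have "(\<Sum>i = 1..k - 1. g i * (if i = k - 1 then 1 else f (i + 1))) =
      (\<Sum>i = 1..k - 1. g i * f (i + 1))"
    by (intro sum.cong) (auto simp: f_def)
  ultimately have "int (num_indep (pascal_graph n)) \<le> delta n + 1 + 2 ^ (n div 2 - 1)
      - (delta (2 ^ k - 2) - 1) * delta_tilde (int n - 2 ^ k - 3)
      - a * (2 * f 1 + (\<Sum>i = 1..k - 1. g i * (if i = k - 1 then 1 else f (i + 1))))"
    using num_indep_pascal_le[of n k, OF _ _ assms(2), THEN of_nat_mono[where 'a = int]]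
    by (simp add: delta_eq_card sum_distrib_left algebra_simps)
  then show ?thesis
    unfolding a_def f_def g_def .
qed

end
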